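(* For a symmetric state $\rho^s\in S$ in $\mathcal{H}_d$, the G-coherence measure is given by $$C_G(\rho^s)=\max\{1-d(1-K),\,0\},$$ where $K=\langle\Psi_d|\rho^s|\Psi_d\rangle$ is the overlap between $\rho^s$ and the maximally coherent state $|\Psi_d\rangle=\frac{1}{\sqrt d}\sum_{i=1}^d|i\rangle$.
   Context: $\mathcal{H}_d$ is a $d$-dimensional Hilbert space with a fixed reference orthonormal basis $\{|i\rangle\}_{i=1,\dots,d}$. Let $G_s$ be the group of all $d!$ permutations of $\{1,\dots,d\}$; for $g\in G_s$ sending $k$ to $i_k$, the corresponding unitary is $U_g=\sum_k|i_k\rangle\langle k|$. A state (density matrix) $\rho$ on $\mathcal{H}_d$ is called a symmetric state if it is invariant under all the permutation unitaries, i.e. $U_g\rho U_g^\dagger=\rho$ for all $g\in G_s$; $S$ denotes the set of symmetric states. The G-coherence measure of a pure state (unit vector) $|\psi\rangle=\sum_{i=1}^d a_i|i\rangle$ is $C_G(|\psi\rangle)=d|a_1a_2\cdots a_d|^{2/d}$. For a general state $\rho$ it is defined by the convex roof $C_G(\rho)=\min_{\{p_i,|\psi_i\rangle\}}\sum_i p_i C_G(|\psi_i\rangle)$, where the minimum runs over all pure-state decompositions $\rho=\sum_i p_i|\psi_i\rangle\langle\psi_i|$ with $p_i\ge 0$ and $\sum_i p_i=1$.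
   Formalization: For d = 2 the overlap K is assumed to be at least 1/2: for d = 2 and K < 1/2 the formula gives 0 but the measure is 1 − 2K > 0 (e.g. the state (|1⟩−|2⟩)/√2 has K = 0 and measure 1). No other dimension is restricted. *)

theory Defs
  imports "HOL-Analysis.Analysis"
begin

text \<open>The Hilbert space of dimension d is \<open>complex ^ 'n\<close> with d = \<open>CARD('n)\<close>; the reference
  orthonormal basis is the standard one, and its norm is the usual Hilbert space norm.\<close>

definition cinner :: "complex ^ 'n \<Rightarrow> complex ^ 'n \<Rightarrow> complex" where
  "cinner \<phi> \<psi> = (\<Sum>i\<in>UNIV. cnj (\<phi> $ i) * \<psi> $ i)"

definition ket :: "'n \<Rightarrow> complex ^ 'n" where
  "ket i = axis i 1"

text \<open>\<open>ketbra \<phi> \<psi>\<close> is the operator |\<phi>\<rangle>\<langle>\<psi>|.\<close>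

definition ketbra :: "complex ^ 'n \<Rightarrow> complex ^ 'n \<Rightarrow> complex ^ 'n ^ 'n" where
  "ketbra \<phi> \<psi> = (\<chi> i j. \<phi> $ i * cnj (\<psi> $ j))"

definition dagger :: "complex ^ 'n ^ 'n \<Rightarrow> complex ^ 'n ^ 'n" where
  "dagger A = (\<chi> i j. cnj (A $ j $ i))"

definition density_matrix :: "complex ^ 'n ^ 'n \<Rightarrow> bool" where
  "density_matrix \<rho> \<longleftrightarrow>
     dagger \<rho> = \<rho> \<and> (\<forall>v. 0 \<le> Re (cinner v (\<rho> *v v))) \<and> trace \<rho> = 1"

definition perm_unitary :: "('n \<Rightarrow> 'n) \<Rightarrow> complex ^ 'n ^ 'n" where
  "perm_unitary g = (\<Sum>k\<in>UNIV. ketbra (ket (g k)) (ket k))"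

definition symmetric_states :: "(complex ^ 'n ^ 'n) set" where
  "symmetric_states = {\<rho>. density_matrix \<rho> \<and>
     (\<forall>g. g permutes UNIV \<longrightarrow> perm_unitary g ** \<rho> ** dagger (perm_unitary g) = \<rho>)}"

definition G_coherence_pure :: "complex ^ 'n \<Rightarrow> real" where
  "G_coherence_pure \<psi> =
     real CARD('n) * cmod (\<Prod>i\<in>UNIV. \<psi> $ i) powr (2 / real CARD('n))"

definition pure_decomposition ::
    "nat \<Rightarrow> (nat \<Rightarrow> real) \<Rightarrow> (nat \<Rightarrow> complex ^ 'n) \<Rightarrow> complex ^ 'n ^ 'n \<Rightarrow> bool" where
  "pure_decomposition m p \<psi> \<rho> \<longleftrightarrow>
     (\<forall>i<m. 0 \<le> p i \<and> norm (\<psi> i) = 1) \<and> (\<Sum>i<m. p i) = 1 \<and>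
     \<rho> = (\<Sum>i<m. p i *\<^sub>R ketbra (\<psi> i) (\<psi> i))"

definition G_coherence_averages :: "complex ^ 'n ^ 'n \<Rightarrow> real set" where
  "G_coherence_averages \<rho> =
     {\<Sum>i<m. p i * G_coherence_pure (\<psi> i) | m p \<psi>. pure_decomposition m p \<psi> \<rho>}"

text \<open>The convex roof is a minimum. \<open>Inf\<close> is the minimum exactly when it belongs to
  \<open>G_coherence_averages \<rho>\<close>, so a statement about the minimum has to assert this membership too.\<close>

definition G_coherence :: "complex ^ 'n ^ 'n \<Rightarrow> real" where
  "G_coherence \<rho> = Inf (G_coherence_averages \<rho>)"

definition max_coherent :: "complex ^ 'n" where
  "max_coherent = (1 / sqrt (real CARD('n))) *\<^sub>R (\<Sum>i\<in>UNIV. ket i)"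

text \<open>\<open>overlap \<rho> \<psi>\<close> is \<langle>\<psi>|\<rho>|\<psi>\<rangle>, which is real whenever \<open>\<rho>\<close> is Hermitian.\<close>

definition overlap :: "complex ^ 'n ^ 'n \<Rightarrow> complex ^ 'n \<Rightarrow> real" where
  "overlap \<rho> \<psi> = Re (cinner \<psi> (\<rho> *v \<psi>))"

end

theory Submission
  imports Defs
begin

text \<open>The lower bound rests on Kober's inequality
  \<open>(\<Sum> x\<^sub>i)\<^sup>2 \<le> (d - 1) \<Sum> x\<^sub>i\<^sup>2 + d (\<Prod> x\<^sub>i) powr (2 / d)\<close> for nonnegative \<open>x\<^sub>i\<close>: applied to the moduli
  of the amplitudes of \<open>\<psi>\<close> it gives \<open>C\<^sub>G(\<psi>) \<ge> 1 - d (1 - |\<langle>\<Psi>\<^sub>d|\<psi>\<rangle>|\<^sup>2)\<close>, and the right-hand side is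
  affine in the projector onto \<open>\<psi>\<close>, so the bound passes to every decomposition of \<open>\<rho>\<close>.

  A symmetric state is determined by its overlap \<open>K\<close>, affinely, so it is a mixture of the symmetric
  states with overlaps \<open>1\<close> (the state \<open>\<Psi>\<^sub>d\<close>, coherence \<open>1\<close>), \<open>1 - 1 / d\<close> (mixing the uniform
  superpositions of all basis vectors but one) and \<open>0\<close> (mixing the \<open>(|a\<rangle> - |b\<rangle>) / \<surd>2\<close>). The pure states
  in the last two mixtures have a vanishing amplitude (for the last one if \<open>d \<ge> 3\<close>), hence
  coherence \<open>0\<close>, so the bound is attained.\<close>


section \<open>Kober's inequality for finite families of nonnegative reals\<close>

lemma AM_GM_sum:
  fixes x :: "'a \<Rightarrow> real"
  assumes "finite S" "S \<noteq> {}" "\<And>i. i \<in> S \<Longrightarrow> 0 \<le> x i"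
  shows "card S * (\<Prod>i\<in>S. x i) powr (1 / card S) \<le> (\<Sum>i\<in>S. x i)"
proof -
  have "card S > 0" using assms by (simp add: card_gt_0_iff)
  then show ?thesis
    using arith_geom_mean[of S x] assms by (simp flip: sum_divide_distrib add: field_simps)
qed

text \<open>Weighted AM-GM with weights \<open>n + 1\<close> and \<open>n - 1\<close>, derived from
  \<open>ln x \<le> x - 1\<close> at \<open>b / (g * t)\<close> and \<open>t / g\<close>, where
  \<open>b\<close> is the \<open>powr\<close> term. The logarithms cancel and the weights sum to
  \<open>2 * n\<close>; multiplying by \<open>g * t\<close> finishes.\<close>

lemma weighted_AM_GM_power:
  fixes t g :: real and n :: nat
  assumes "0 \<le> t" "0 < g" "0 < n"
  shows "2 * n * g * t \<le> (n - 1) * t\<^sup>2 + (n + 1) * (t * g ^ n) powr (2 / (n + 1))"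
proof (cases "t = 0")
  case True
  then show ?thesis by simp
next
  case False
  with assms have t: "0 < t" by simp
  define b where "b = (t * g ^ n) powr (2 / (n + 1))"
  have b: "0 < b" using t assms by (simp add: b_def)
  have lnb: "(n + 1) * ln b = 2 * (ln t + n * ln g)"
    using t assms by (simp add: b_def ln_powr ln_mult_pos ln_realpow)
  have "(real n + 1) * (1 + ln (b / (g * t))) \<le> (real n + 1) * (b / (g * t))"
    using ln_le_minus_one[of "b / (g * t)"] b t assms by (intro mult_left_mono) auto
  moreover have "(real n - 1) * (1 + ln (t / g)) \<le> (real n - 1) * (t / g)"
    using ln_le_minus_one[of "t / g"] t assms by (intro mult_left_mono) auto
  moreover have "(real n + 1) * (1 + ln (b / (g * t))) + (real n - 1) * (1 + ln (t / g)) = 2 * n"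
    using lnb b t assms by (simp add: ln_div ln_mult_pos algebra_simps)
  ultimately have "2 * n \<le> (real n - 1) * (t / g) + (real n + 1) * (b / (g * t))"
    by linarith
  then have "2 * n * (g * t) \<le> ((real n - 1) * (t / g) + (real n + 1) * (b / (g * t))) * (g * t)"
    using t assms by (intro mult_right_mono) auto
  also have "\<dots> = (n - 1) * t\<^sup>2 + (n + 1) * b"
    using t assms by (simp add: field_simps power2_eq_square of_nat_diff)
  finally show ?thesis by (simp add: b_def algebra_simps)
qed

lemma sum_sq_le_geometric_mean:
  fixes x :: "'a \<Rightarrow> real"
  assumes "finite S" "S \<noteq> {}" "\<And>i. i \<in> S \<Longrightarrow> 0 \<le> x i"
  shows "(\<Sum>i\<in>S. x i)\<^sup>2 \<le> (real (card S) - 1) * (\<Sum>i\<in>S. (x i)\<^sup>2)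
           + card S * (\<Prod>i\<in>S. x i) powr (2 / card S)"
  using assms
\<comment> \<open>The ranking inserts the smallest element \<open>t\<close> last, so that \<open>t \<le> g\<close> for the geometric mean \<open>g\<close>
  of the others.\<close>
proof (induction S rule: finite_ranking_induct[where f = "\<lambda>i. - x i"])
  case empty
  then show ?case by simp
next
  case (insert k T)
  show ?case
  \<comment> \<open>The induction rule allows \<open>k \<in> T\<close>, where the set does not
    change; for \<open>T = {}\<close> both sides are \<open>(x k)\<^sup>2\<close>.\<close>
  proof (cases "k \<in> T \<or> T = {}")
    case True
    then show ?thesis
      using insert.IH insert.prems
      by (cases "T = {}") (auto simp: insert_absorb powr_numeral)
  next
    case False
    define n where "n = card T"
    define t where "t = x k"
    define P where "P = (\<Prod>i\<in>T. x i)"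
    define g where "g = P powr (1 / n)"
    define Q where "Q = (\<Sum>i\<in>T. (x i)\<^sup>2)"
    define s where "s = (\<Sum>i\<in>T. x i)"
    have n: "0 < n" using False insert.hyps by (simp add: n_def card_gt_0_iff)
    have t: "0 \<le> t" "\<And>i. i \<in> T \<Longrightarrow> t \<le> x i"
      using insert.hyps insert.prems by (auto simp: t_def)
    have P: "0 \<le> P" using insert.prems by (auto simp: P_def intro: prod_nonneg)
    have gn: "g ^ n = P"
      using n P by (cases "P = 0") (auto simp: g_def powr_powr simp flip: powr_realpow)
    have g2: "P powr (2 / n) = g\<^sup>2"
      using P by (cases "P = 0") (auto simp: g_def powr_powr simp flip: powr_numeral)
    have "t ^ n \<le> P"
      using t prod_mono[of T "\<lambda>_. t" x] by (simp add: P_def n_def)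
    then have tg: "t \<le> g"
      using gn n t by (metis g_def power_mono_iff powr_ge_zero)
    have IH: "s\<^sup>2 \<le> (real n - 1) * Q + n * g\<^sup>2"
      using insert.IH False insert.prems by (simp add: n_def Q_def s_def P_def flip: g2)
    have "n * g \<le> s"
      using AM_GM_sum[of T x] False insert by (simp add: n_def g_def P_def s_def)
    \<comment> \<open>Adding this product to the sum of squares about \<open>g\<close> eliminates
      \<open>g * s\<close> and leaves \<open>tangent\<close>. The product is nonnegative because
      \<open>t \<le> g\<close> and, by AM-GM, \<open>n * g \<le> s\<close>.\<close>
    then have "0 \<le> 2 * (g - t) * (s - n * g)" using tg by simp
    moreover have "0 \<le> (\<Sum>i\<in>T. (x i - g)\<^sup>2)" by (simp add: sum_nonneg)
    moreover have "(\<Sum>i\<in>T. (x i - g)\<^sup>2) = Q - 2 * g * s + n * g\<^sup>2"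
      by (simp add: power2_diff sum.distrib sum_subtractf Q_def s_def n_def
          flip: sum_distrib_left sum_distrib_right)
    ultimately have tangent: "n * (g\<^sup>2 - 2 * t * g) \<le> Q - 2 * t * s"
      by (simp add: algebra_simps power2_eq_square)
    have step: "2 * n * g * t \<le> (n - 1) * t\<^sup>2 + (n + 1) * (t * P) powr (2 / (n + 1))"
    proof (cases "g = 0")
      case True
      then show ?thesis using tg t by simp
    next
      case False
      then have "0 < g" by (simp add: g_def)
      from weighted_AM_GM_power[OF t(1) this n] show ?thesis by (simp add: gn)
    qed
    have "(\<Sum>i\<in>insert k T. x i)\<^sup>2 = s\<^sup>2 + 2 * t * s + t\<^sup>2"
      using False insert.hyps by (simp add: s_def t_def power2_sum)
    \<comment> \<open>After \<open>IH\<close> it remains to bound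
      \<open>n * g\<^sup>2 + 2 * t * s\<close>: \<open>tangent\<close> replaces it by
      \<open>Q + 2 * n * g * t\<close>, and \<open>step\<close> bounds the last term.\<close>
    also have "\<dots> \<le> n * (Q + t\<^sup>2) + (n + 1) * (t * P) powr (2 / (n + 1))"
      using IH tangent step n by (simp add: algebra_simps of_nat_diff)
    finally show ?thesis
      using False insert.hyps by (simp add: n_def Q_def P_def t_def add.commute)
  qed
qed


section \<open>Symmetric states as a one-parameter family\<close>

text \<open>For \<open>CARD('n) = 1\<close> the off-diagonal quotient is \<open>x / 0\<close>, but no off-diagonal entry exists.\<close>

definition symmetric_state_of_overlap :: "real \<Rightarrow> complex ^ 'n ^ 'n" where
  "symmetric_state_of_overlap K = (\<chi> i j. of_real (if i = j then 1 / CARD('n)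
     else (real CARD('n) * K - 1) / (real CARD('n) * (real CARD('n) - 1))))"

lemma max_coherent_nth: "max_coherent $ i = of_real (1 / sqrt CARD('n))"
  for i :: "'n::finite"
  by (simp add: max_coherent_def ket_def axis_def scaleR_conv_of_real[where ?'a = complex])

lemma overlap_max_coherent:
  fixes \<rho> :: "complex ^ 'n ^ 'n"
  shows "overlap \<rho> max_coherent = (\<Sum>i\<in>UNIV. \<Sum>j\<in>UNIV. Re (\<rho> $ i $ j)) / CARD('n)"
  by (simp add: overlap_def cinner_def matrix_vector_mult_def max_coherent_nth
      sum_distrib_left sum_divide_distrib del: of_real_divide)

lemma norm_vec_eq_1_iff:
  fixes \<psi> :: "complex ^ 'n"
  shows "norm \<psi> = 1 \<longleftrightarrow> (\<Sum>i\<in>UNIV. (cmod (\<psi> $ i))\<^sup>2) = 1"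
  by (simp add: norm_vec_def L2_set_def)

lemma cnj_of_bool [simp]: "cnj (of_bool P) = of_bool P"
  by simp

lemma ket_nth: "ket a $ i = of_bool (i = a)"
  by (simp add: ket_def axis_def)

lemma perm_unitary_nth:
  "perm_unitary g $ i $ j = of_bool (i = g j)"
  by (simp add: perm_unitary_def ketbra_def ket_nth)

lemma perm_conjugation_nth:
  fixes \<rho> :: "complex ^ 'n ^ 'n"
  assumes "g permutes UNIV"
  shows "(perm_unitary g ** \<rho> ** dagger (perm_unitary g)) $ g i $ g j = \<rho> $ i $ j"
  using permutes_inj[OF assms]
  by (simp add: matrix_matrix_mult_def dagger_def perm_unitary_nth inj_eq)

lemma symmetric_states_nth_permutes:
  assumes "\<rho> \<in> symmetric_states" "g permutes UNIV"
  shows "\<rho> $ g i $ g j = \<rho> $ i $ j"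
  using assms perm_conjugation_nth[of g \<rho> i j] by (simp add: symmetric_states_def)

lemma permutes_doubly_transitive:
  assumes "i \<noteq> j" "k \<noteq> l"
  obtains g where "g permutes UNIV" "g i = k" "g j = l"
proof
  \<comment> \<open>First \<open>i\<close> is sent to \<open>k\<close>, then the image of
    \<open>j\<close> to \<open>l\<close>; the second swap fixes \<open>k\<close>, as neither
    \<open>?f j\<close> nor \<open>l\<close> equals \<open>k\<close>.\<close>
  let ?f = "Transposition.transpose i k"
  show "(Transposition.transpose (?f j) l \<circ> ?f) permutes UNIV"
    by (intro permutes_compose permutes_swap_id) auto
  show "(Transposition.transpose (?f j) l \<circ> ?f) i = k" "(Transposition.transpose (?f j) l \<circ> ?f) j = l"
    using assms by (auto simp: Transposition.transpose_def)
qed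

text \<open>Transitivity of the permutations makes the diagonal constant, and the trace fixes its
  value. Double transitivity makes the off-diagonal entries equal; swapping the two indices then
  turns Hermiticity into reality.\<close>

lemma symmetric_states_entries:
  fixes \<rho> :: "complex ^ 'n ^ 'n"
  assumes "\<rho> \<in> symmetric_states"
  obtains c :: real where "\<And>i j. \<rho> $ i $ j = of_real (if i = j then 1 / CARD('n) else c)"
proof -
  note perm = symmetric_states_nth_permutes[OF assms]
  have dens: "density_matrix \<rho>" using assms by (simp add: symmetric_states_def)
  have diag_eq: "\<rho> $ i $ i = \<rho> $ k $ k" for i k
    using perm[of "Transposition.transpose i k" i i] by (simp add: permutes_swap_id)
  have diag: "\<rho> $ k $ k = of_real (1 / CARD('n))" for k
  proof -
    have "(\<Sum>i::'n\<in>UNIV. \<rho> $ i $ i) = 1"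
      using dens by (simp add: density_matrix_def trace_def)
    moreover have "(\<Sum>i::'n\<in>UNIV. \<rho> $ i $ i) = (\<Sum>i::'n\<in>UNIV. \<rho> $ k $ k)"
      by (intro sum.cong refl diag_eq)
    ultimately have "of_nat CARD('n) * \<rho> $ k $ k = 1" by simp
    then show ?thesis by (simp add: field_simps)
  qed
  have off: "\<rho> $ i $ j = \<rho> $ k $ l" if "i \<noteq> j" "k \<noteq> l" for i j k l
    using permutes_doubly_transitive[OF that] perm by metis
  have herm: "\<rho> $ i $ j = cnj (\<rho> $ j $ i)" for i j
  proof -
    have "dagger \<rho> $ i $ j = \<rho> $ i $ j" using dens by (simp add: density_matrix_def)
    then show ?thesis by (simp add: dagger_def)
  qed
  have "\<exists>c::real. \<forall>i j. i \<noteq> j \<longrightarrow> \<rho> $ i $ j = of_real c"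
  proof (cases "\<exists>a b::'n. a \<noteq> b")
    case True
    then obtain a b :: 'n where ab: "a \<noteq> b" by blast
    have "cnj (\<rho> $ a $ b) = \<rho> $ a $ b"
      using herm[of b a] off[of a b b a] ab by simp
    then have "\<rho> $ a $ b = of_real (Re (\<rho> $ a $ b))"
      by (simp add: complex_eq_iff)
    then show ?thesis using off ab by metis
  qed auto
  then obtain c :: real where "\<And>i j. i \<noteq> j \<Longrightarrow> \<rho> $ i $ j = of_real c" by blast
  then show thesis by (intro that[of c]) (simp add: diag)
qed

text \<open>With off-diagonal entry \<open>c\<close>, the eigenvalues are
  \<open>K = 1 / d + (d - 1) * c\<close> on \<open>max_coherent\<close> and \<open>1 / d - c\<close>
  on its orthogonal complement, tested on \<open>ket a - ket b\<close>. Solving the first for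
  \<open>c\<close> gives the entries; nonnegativity of the two gives the bounds on
  \<open>K\<close>.\<close>

lemma symmetric_states_eq:
  fixes \<rho> :: "complex ^ 'n ^ 'n"
  assumes "\<rho> \<in> symmetric_states"
  defines "K \<equiv> overlap \<rho> max_coherent"
  shows "\<rho> = symmetric_state_of_overlap K" "0 \<le> K" "K \<le> 1" "CARD('n) = 1 \<Longrightarrow> K = 1"
proof -
  obtain c :: real where entries: "\<And>i j. \<rho> $ i $ j = of_real (if i = j then 1 / CARD('n) else c)"
    using symmetric_states_entries[OF assms(1)] by blast
  have pos: "0 \<le> Re (cinner v (\<rho> *v v))" for v
    using assms by (simp add: symmetric_states_def density_matrix_def)
  show "0 \<le> K" using pos by (simp add: K_def overlap_def)
  have "(\<Sum>j\<in>UNIV. if i = j then 1 / CARD('n) else c) = 1 / CARD('n) + (real CARD('n) - 1) * c"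
    for i :: 'n
    by (subst sum.remove[of _ i]) (simp_all add: card_Diff_singleton of_nat_diff)
  then have K: "K = 1 / CARD('n) + (real CARD('n) - 1) * c"
    by (simp add: K_def overlap_max_coherent entries)
  then show "CARD('n) = 1 \<Longrightarrow> K = 1" by simp
  have c: "c = (real CARD('n) * K - 1) / (real CARD('n) * (real CARD('n) - 1))" if "i \<noteq> j" for i j :: 'n
  proof -
    have "card {i, j} \<le> CARD('n)" by (intro card_mono) auto
    then have "real CARD('n) > 1" using that by simp
    then show ?thesis by (simp add: K field_simps of_nat_diff)
  qed
  then show "\<rho> = symmetric_state_of_overlap K"
    by (simp add: vec_eq_iff symmetric_state_of_overlap_def entries)
  show "K \<le> 1"
  proof (cases "CARD('n) = 1")
    case False
    then obtain a b :: 'n where ab: "a \<noteq> b"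
      by (metis (full_types) UNIV_eq_I card_1_singleton_iff One_nat_def singletonI)
    have inner: "(\<rho> *v (ket a - ket b)) $ i = \<rho> $ i $ a - \<rho> $ i $ b" for i
      by (simp add: matrix_vector_mult_def ket_def axis_def algebra_simps sum_subtractf
          if_distrib[of "\<lambda>x. _ * x"] cong: if_cong)
    have "cinner (ket a - ket b) v = v $ a - v $ b" for v :: "complex ^ 'n"
      by (simp add: cinner_def ket_def axis_def algebra_simps sum_subtractf
          if_distrib[of "\<lambda>x. _ * x"] if_distrib[of cnj] cong: if_cong)
    then have "cinner (ket a - ket b) (\<rho> *v (ket a - ket b)) = of_real (2 * (1 / CARD('n) - c))"
      using ab by (simp add: inner entries)
    then have "c \<le> 1 / CARD('n)"
      using pos[of "ket a - ket b"] by simp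
    then have "K \<le> 1 / CARD('n) + (real CARD('n) - 1) * (1 / CARD('n))"
      unfolding K by (intro add_mono mult_left_mono) auto
    then show ?thesis by (simp add: field_simps)
  qed (simp add: K)
qed

section \<open>Lower bound on every pure-state average\<close>

lemma overlap_ketbra_max_coherent:
  fixes \<psi> :: "complex ^ 'n"
  shows "overlap (ketbra \<psi> \<psi>) max_coherent = (cmod (\<Sum>i\<in>UNIV. \<psi> $ i))\<^sup>2 / CARD('n)"
proof -
  have "complex_of_real ((cmod (\<Sum>i\<in>UNIV. \<psi> $ i))\<^sup>2) = (\<Sum>i\<in>UNIV. \<Sum>j\<in>UNIV. \<psi> $ i * cnj (\<psi> $ j))"
    by (simp only: complex_norm_square cnj_sum sum_product)
  then have "(cmod (\<Sum>i\<in>UNIV. \<psi> $ i))\<^sup>2 = (\<Sum>i\<in>UNIV. \<Sum>j\<in>UNIV. Re (\<psi> $ i * cnj (\<psi> $ j)))"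
    by (metis (no_types, lifting) Re_complex_of_real Re_sum sum.cong)
  then show ?thesis by (simp add: overlap_max_coherent ketbra_def)
qed

text \<open>The triangle inequality discards the phases; Kober's inequality then applies to the
  moduli, whose squares sum to \<open>1\<close>.\<close>

lemma G_coherence_pure_ge:
  fixes \<psi> :: "complex ^ 'n"
  assumes "norm \<psi> = 1"
  shows "1 - CARD('n) * (1 - overlap (ketbra \<psi> \<psi>) max_coherent) \<le> G_coherence_pure \<psi>"
proof -
  have "(cmod (\<Sum>i\<in>UNIV. \<psi> $ i))\<^sup>2 \<le> (\<Sum>i\<in>UNIV. cmod (\<psi> $ i))\<^sup>2"
    by (intro power_mono norm_sum) simp
  also have "\<dots> \<le> (real CARD('n) - 1) * (\<Sum>i\<in>UNIV. (cmod (\<psi> $ i))\<^sup>2)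
      + CARD('n) * (\<Prod>i\<in>UNIV. cmod (\<psi> $ i)) powr (2 / CARD('n))"
    by (intro sum_sq_le_geometric_mean) auto
  finally show ?thesis
    using assms unfolding norm_vec_eq_1_iff
    by (simp add: overlap_ketbra_max_coherent G_coherence_pure_def algebra_simps prod_norm)
qed

lemma G_coherence_averages_ge:
  fixes \<rho> :: "complex ^ 'n ^ 'n"
  assumes "a \<in> G_coherence_averages \<rho>"
  shows "1 - CARD('n) * (1 - overlap \<rho> max_coherent) \<le> a" "0 \<le> a"
proof -
  from assms obtain m p \<psi> where dec: "pure_decomposition m p \<psi> \<rho>"
    and a: "a = (\<Sum>i<m. p i * G_coherence_pure (\<psi> i))"
    by (auto simp: G_coherence_averages_def)
  have p: "\<And>i. i < m \<Longrightarrow> 0 \<le> p i" "\<And>i. i < m \<Longrightarrow> norm (\<psi> i) = 1" "(\<Sum>i<m. p i) = 1"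
    and \<rho>: "\<rho> = (\<Sum>i<m. p i *\<^sub>R ketbra (\<psi> i) (\<psi> i))"
    using dec by (auto simp: pure_decomposition_def)
  show "0 \<le> a"
    unfolding a by (intro sum_nonneg mult_nonneg_nonneg) (auto simp: p G_coherence_pure_def)
  have "overlap \<rho> max_coherent
      = (\<Sum>i\<in>UNIV. \<Sum>j\<in>UNIV. \<Sum>k<m. p k * Re (ketbra (\<psi> k) (\<psi> k) $ i $ j)) / CARD('n)"
    by (simp add: overlap_max_coherent \<rho>)
  also have "\<dots> = (\<Sum>k<m. p k * overlap (ketbra (\<psi> k) (\<psi> k)) max_coherent)"
    by (simp add: overlap_max_coherent sum_distrib_left sum_divide_distrib sum.swap[of _ "{..<m}"])
  finally have K: "overlap \<rho> max_coherent = (\<Sum>k<m. p k * overlap (ketbra (\<psi> k) (\<psi> k)) max_coherent)" .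
  \<comment> \<open>As the weights sum to \<open>1\<close>, the constant \<open>1 - d\<close> can be
    spread over the terms.\<close>
  have "1 - CARD('n) * (1 - overlap \<rho> max_coherent)
      = (\<Sum>k<m. p k * (1 - CARD('n) * (1 - overlap (ketbra (\<psi> k) (\<psi> k)) max_coherent)))"
  proof -
    have "(\<Sum>k<m. p k * (1 - CARD('n) * (1 - overlap (ketbra (\<psi> k) (\<psi> k)) max_coherent)))
        = (\<Sum>k<m. (1 - real CARD('n)) * p k
             + CARD('n) * (p k * overlap (ketbra (\<psi> k) (\<psi> k)) max_coherent))"
      by (simp add: algebra_simps)
    also have "\<dots> = 1 - real CARD('n) + CARD('n) * overlap \<rho> max_coherent"
      by (simp only: sum.distrib p(3) K mult_1_right flip: sum_distrib_left)
    finally show ?thesis by (simp add: algebra_simps)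
  qed
  also have "\<dots> \<le> a"
    unfolding a by (intro sum_mono mult_left_mono G_coherence_pure_ge) (auto simp: p)
  finally show "1 - CARD('n) * (1 - overlap \<rho> max_coherent) \<le> a" .
qed

section \<open>Building and mixing decompositions\<close>

text \<open>Enumerating \<open>I\<close> frees later decompositions from natural-number indices:
  they run over basis indices, pairs or disjoint sums.\<close>

lemma G_coherence_averagesI:
  assumes "finite I" "\<And>i. i \<in> I \<Longrightarrow> 0 \<le> p i" "\<And>i. i \<in> I \<Longrightarrow> norm (\<psi> i) = 1"
    and "(\<Sum>i\<in>I. p i) = 1" "\<rho> = (\<Sum>i\<in>I. p i *\<^sub>R ketbra (\<psi> i) (\<psi> i))"
  shows "(\<Sum>i\<in>I. p i * G_coherence_pure (\<psi> i)) \<in> G_coherence_averages \<rho>"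
proof -
  obtain h where h: "bij_betw h {..<card I} I"
    using ex_bij_betw_nat_finite[OF assms(1)] by (auto simp: atLeast0LessThan)
  note reindex = sum.reindex_bij_betw[OF h, symmetric]
  have "h i \<in> I" if "i < card I" for i
    using h that by (auto simp: bij_betw_def)
  then have "pure_decomposition (card I) (p \<circ> h) (\<psi> \<circ> h) \<rho>"
    using assms reindex[of p] reindex[of "\<lambda>i. p i *\<^sub>R ketbra (\<psi> i) (\<psi> i)"]
    by (simp add: pure_decomposition_def)
  then show ?thesis
    unfolding reindex[of "\<lambda>i. p i * G_coherence_pure (\<psi> i)"]
      G_coherence_averages_def mem_Collect_eq
    by (intro exI[of _ "card I"] exI[of _ "p \<circ> h"] exI[of _ "\<psi> \<circ> h"]) simp
qed

text \<open>The two decompositions are joined over the disjoint sum of their index sets, with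
  weights scaled by \<open>u\<close> and \<open>1 - u\<close>.\<close>

lemma G_coherence_averages_convex:
  assumes a: "a \<in> G_coherence_averages \<rho>" and b: "b \<in> G_coherence_averages \<sigma>"
    and u: "0 \<le> u" "u \<le> 1"
  shows "u * a + (1 - u) * b \<in> G_coherence_averages (u *\<^sub>R \<rho> + (1 - u) *\<^sub>R \<sigma>)"
proof -
  from a obtain m p \<psi> where 1: "pure_decomposition m p \<psi> \<rho>"
    "a = (\<Sum>i<m. p i * G_coherence_pure (\<psi> i))"
    by (auto simp: G_coherence_averages_def)
  from b obtain n q \<phi> where 2: "pure_decomposition n q \<phi> \<sigma>"
    "b = (\<Sum>i<n. q i * G_coherence_pure (\<phi> i))"
    by (auto simp: G_coherence_averages_def)
  define r where "r = case_sum (\<lambda>i. u * p i) (\<lambda>i. (1 - u) * q i)"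
  define \<eta> where "\<eta> = case_sum \<psi> \<phi>"
  let ?I = "{..<m} <+> {..<n}"
  have "(\<Sum>i\<in>?I. r i * G_coherence_pure (\<eta> i)) \<in> G_coherence_averages (u *\<^sub>R \<rho> + (1 - u) *\<^sub>R \<sigma>)"
  proof (rule G_coherence_averagesI)
    show "finite ?I" by simp
    show "0 \<le> r i" "norm (\<eta> i) = 1" if "i \<in> ?I" for i
      using that 1 2 u by (auto simp: r_def \<eta>_def pure_decomposition_def)
    show "(\<Sum>i\<in>?I. r i) = 1"
      using 1 2 by (simp add: sum.Plus r_def pure_decomposition_def flip: sum_distrib_left)
    show "u *\<^sub>R \<rho> + (1 - u) *\<^sub>R \<sigma> = (\<Sum>i\<in>?I. r i *\<^sub>R ketbra (\<eta> i) (\<eta> i))"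
      using 1 2 by (simp add: sum.Plus r_def \<eta>_def pure_decomposition_def scaleR_sum_right)
  qed
  then show ?thesis
    using 1 2 by (simp add: sum.Plus r_def \<eta>_def sum_distrib_left mult.assoc)
qed

lemma symmetric_state_of_overlap_convex:
  "u *\<^sub>R symmetric_state_of_overlap K + (1 - u) *\<^sub>R symmetric_state_of_overlap L
     = symmetric_state_of_overlap (u * K + (1 - u) * L)"
  by (simp add: vec_eq_iff symmetric_state_of_overlap_def scaleR_conv_of_real[where ?'a = complex]
      algebra_simps diff_divide_distrib add_divide_distrib flip: of_real_mult of_real_add of_real_diff)

section \<open>Decompositions of the states with overlaps \<open>1\<close>, \<open>1 - 1 / d\<close>
  and \<open>0\<close>\<close>

lemma one_mem_G_coherence_averages:
  "1 \<in> G_coherence_averages (symmetric_state_of_overlap 1 :: complex ^ 'n ^ 'n)"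
proof -
  let ?\<Psi> = "max_coherent :: complex ^ 'n"
  have "(\<Sum>i\<in>{()}. 1 * G_coherence_pure ?\<Psi>) \<in> G_coherence_averages (symmetric_state_of_overlap 1 :: complex ^ 'n ^ 'n)"
  proof (rule G_coherence_averagesI)
    show "norm ?\<Psi> = 1"
      by (simp add: norm_vec_eq_1_iff max_coherent_nth norm_divide power_divide)
    have "of_real (sqrt CARD('n)) * of_real (sqrt CARD('n)) = (of_nat CARD('n) :: complex)"
      by (simp flip: of_real_mult)
    moreover have "real CARD('n) - 1 \<noteq> 0" if "i \<noteq> j" for i j :: 'n
      using card_mono[of UNIV "{i, j}"] that by auto
    ultimately show "symmetric_state_of_overlap 1 = (\<Sum>i\<in>{()}. 1 *\<^sub>R ketbra ?\<Psi> ?\<Psi>)"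
      by (auto simp add: vec_eq_iff symmetric_state_of_overlap_def ketbra_def max_coherent_nth)
  qed auto
  moreover have "G_coherence_pure ?\<Psi> = 1"
  proof -
    have "cmod (\<Prod>i\<in>UNIV. ?\<Psi> $ i) = (1 / sqrt CARD('n)) ^ CARD('n)"
      by (simp add: max_coherent_nth norm_power norm_divide)
    moreover have "((1 / sqrt CARD('n)) ^ CARD('n)) powr (2 / CARD('n)) = (1 / sqrt CARD('n))\<^sup>2"
      by (simp add: powr_powr flip: powr_realpow powr_numeral)
    ultimately show ?thesis
      by (simp add: G_coherence_pure_def power_divide)
  qed
  ultimately show ?thesis by simp
qed

lemma G_coherence_pure_eq_0:
  assumes "\<psi> $ i = 0"
  shows "G_coherence_pure \<psi> = 0"
proof -
  have "(\<Prod>i\<in>UNIV. \<psi> $ i) = 0" using assms by auto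
  then show ?thesis by (simp add: G_coherence_pure_def)
qed

lemma zero_mem_G_coherence_averages:
  fixes p :: "'i \<Rightarrow> real" and \<psi> :: "'i \<Rightarrow> complex ^ 'n"
  assumes "finite I" "\<And>i. i \<in> I \<Longrightarrow> 0 \<le> p i" "\<And>i. i \<in> I \<Longrightarrow> norm (\<psi> i) = 1"
    and "(\<Sum>i\<in>I. p i) = 1" "\<rho> = (\<Sum>i\<in>I. p i *\<^sub>R ketbra (\<psi> i) (\<psi> i))"
    and "\<And>i. i \<in> I \<Longrightarrow> \<exists>k. \<psi> i $ k = 0"
  shows "0 \<in> G_coherence_averages \<rho>"
proof -
  have "(\<Sum>i\<in>I. p i * G_coherence_pure (\<psi> i)) = 0"
    using assms(6) by (intro sum.neutral) (auto dest: G_coherence_pure_eq_0)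
  then show ?thesis using G_coherence_averagesI[OF assms(1-5)] by simp
qed

text \<open>The overlap \<open>1 - 1 / d\<close> is the zero of \<open>1 - d * (1 - K)\<close>. Each
  vector \<open>?\<psi> j\<close> has amplitude sum \<open>sqrt (d - 1)\<close>, which gives this
  overlap.\<close>

lemma zero_mem_G_coherence_averages_punctured:
  assumes d: "2 \<le> CARD('n)"
  shows "0 \<in> G_coherence_averages (symmetric_state_of_overlap (1 - 1 / CARD('n)) :: complex ^ 'n ^ 'n)"
proof (rule zero_mem_G_coherence_averages)
  let ?\<psi> = "\<lambda>j. (\<chi> i. if i = j then 0 else of_real (1 / sqrt (real CARD('n) - 1))) :: complex ^ 'n"
  have d1: "real CARD('n) - 1 > 0" using d by simp
  have sq: "of_real (sqrt (real CARD('n) - 1)) * (of_real (sqrt (real CARD('n) - 1)) * z)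
      = of_real (real CARD('n) - 1) * z" for z :: complex
    using d1 by (simp del: of_real_diff flip: mult.assoc of_real_mult)
  show "norm (?\<psi> j) = 1" for j
    using d1 by (simp add: norm_vec_eq_1_iff if_distrib[of cmod] if_distrib[of "\<lambda>x. x\<^sup>2"] norm_divide power_divide
        sum.remove[of UNIV j] card_Diff_singleton of_nat_diff cong: if_cong)
  show "symmetric_state_of_overlap (1 - 1 / CARD('n)) = (\<Sum>j\<in>UNIV. (1 / CARD('n)) *\<^sub>R ketbra (?\<psi> j) (?\<psi> j))"
  proof -
    have "(\<Sum>l\<in>UNIV. ((1 / CARD('n)) *\<^sub>R ketbra (?\<psi> l) (?\<psi> l)) $ i $ j)
        = symmetric_state_of_overlap (1 - 1 / CARD('n)) $ i $ j" for i j :: 'n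
    proof -
      \<comment> \<open>Only \<open>l\<close> outside \<open>{i, j}\<close> contributes to entry
        \<open>(i, j)\<close>: \<open>d - 1\<close> terms on the diagonal, \<open>d - 2\<close> off
        it.\<close>
      have "(\<Sum>l\<in>UNIV. ((1 / CARD('n)) *\<^sub>R ketbra (?\<psi> l) (?\<psi> l)) $ i $ j)
        = (\<Sum>l\<in>- {i, j}. of_real (1 / (CARD('n) * (real CARD('n) - 1))))"
        using d1 by (intro sum.mono_neutral_cong_right)
          (auto simp: ketbra_def scaleR_conv_of_real[where ?'a = complex] sq)
      also have "\<dots> = of_real ((CARD('n) - card {i, j}) / (CARD('n) * (real CARD('n) - 1)))"
        by (simp add: Compl_eq_Diff_UNIV card_Diff_subset)
      also have "\<dots> = symmetric_state_of_overlap (1 - 1 / CARD('n)) $ i $ j"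
        using d d1 by (auto simp: symmetric_state_of_overlap_def of_nat_diff field_simps)
      finally show ?thesis .
    qed
    then show ?thesis by (simp add: vec_eq_iff)
  qed
  show "\<exists>k. ?\<psi> j $ k = 0" for j by auto
qed auto

text \<open>The two nonzero amplitudes of each vector cancel in the sum, whence the overlap
  \<open>0\<close>; \<open>3 \<le> d\<close> leaves a third index with amplitude
  \<open>0\<close>.\<close>

lemma zero_mem_G_coherence_averages_antisymmetric:
  assumes d: "3 \<le> CARD('n)"
  shows "0 \<in> G_coherence_averages (symmetric_state_of_overlap 0 :: complex ^ 'n ^ 'n)"
proof (rule zero_mem_G_coherence_averages)
  let ?I = "{(a, b). a \<noteq> b} :: ('n \<times> 'n) set"
  let ?\<psi> = "\<lambda>(a, b). (\<chi> i. of_real ((of_bool (i = a) - of_bool (i = b)) / sqrt 2)) :: complex ^ 'n"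
  let ?p = "1 / (real CARD('n) * (real CARD('n) - 1))"
  have sum_I: "(\<Sum>x\<in>?I. f x) = (\<Sum>a\<in>UNIV. \<Sum>b\<in>UNIV. f (a, b))"
    if "\<And>a. f (a, a) = 0" for f :: "'n \<times> 'n \<Rightarrow> real"
    using that by (simp add: sum.cartesian_product) (intro sum.mono_neutral_left, auto)
  show "finite ?I" by simp
  show "norm (?\<psi> x) = 1" if "x \<in> ?I" for x
  proof -
    from that obtain a b where x: "x = (a, b)" "a \<noteq> b" by auto
    have "(\<Sum>i\<in>UNIV. (cmod (?\<psi> x $ i))\<^sup>2) = (\<Sum>i\<in>{a, b}. 1 / 2)"
      using x by (intro sum.mono_neutral_cong_right) (auto simp: norm_divide power_divide)
    then show ?thesis using x by (simp add: norm_vec_eq_1_iff)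
  qed
  show "(\<Sum>x\<in>?I. ?p) = 1"
  proof -
    \<comment> \<open>The summand is rewritten so as to vanish on the diagonal, as
      \<open>sum_I\<close> requires.\<close>
    have "(\<Sum>x\<in>?I. 1::real) = (\<Sum>x\<in>?I. 1 - of_bool (fst x = snd x))"
      by (intro sum.cong) auto
    also have "\<dots> = CARD('n) * (real CARD('n) - 1)"
      by (subst sum_I) (simp_all add: sum_subtractf)
    finally show ?thesis using d by simp
  qed
  show "symmetric_state_of_overlap 0 = (\<Sum>x\<in>?I. ?p *\<^sub>R ketbra (?\<psi> x) (?\<psi> x))"
  proof -
    have "(\<Sum>x\<in>?I. (?p *\<^sub>R ketbra (?\<psi> x) (?\<psi> x)) $ i $ j)
        = symmetric_state_of_overlap 0 $ i $ j" for i j :: 'n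
    proof -
      let ?f = "\<lambda>(a, b). (of_bool (i = a) - of_bool (i = b)) * (of_bool (j = a) - of_bool (j = b)) / 2 :: real"
      have "(\<Sum>x\<in>?I. (?p *\<^sub>R ketbra (?\<psi> x) (?\<psi> x)) $ i $ j)
          = (\<Sum>x\<in>?I. of_real (?p * ?f x))"
        by (intro sum.cong refl)
         (auto simp: ketbra_def scaleR_conv_of_real[where ?'a = complex] simp flip: of_real_mult of_real_diff)
      also have "\<dots> = of_real (?p * (\<Sum>x\<in>?I. ?f x))"
        by (simp add: sum_distrib_left)
      also have "(\<Sum>x\<in>?I. ?f x) = (\<Sum>a\<in>UNIV. \<Sum>b\<in>UNIV. ?f (a, b))"
        by (rule sum_I) simp
      \<comment> \<open>Multiplied out, the two unmixed terms survive only for \<open>i = j\<close>,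
        and each mixed term picks a single pair \<open>(a, b)\<close>.\<close>
      also have "\<dots> = (\<Sum>a\<in>UNIV. \<Sum>b\<in>UNIV. of_bool (i = j) / 2 * (of_bool (a = i) + of_bool (b = i))
          - (of_bool (a = i) * of_bool (b = j) + of_bool (a = j) * of_bool (b = i)) / 2)"
        by (intro sum.cong refl) (auto simp: of_bool_def)
      also have "\<dots> = of_bool (i = j) * real CARD('n) - 1"
        by (simp add: sum.distrib sum_subtractf flip: sum_distrib_left sum_divide_distrib)
      also have "of_real (?p * (of_bool (i = j) * real CARD('n) - 1)) = symmetric_state_of_overlap 0 $ i $ j"
        using d by (auto simp: symmetric_state_of_overlap_def field_simps)
      finally show ?thesis .
    qed
    then show ?thesis by (simp add: vec_eq_iff)
  qed
  show "\<exists>k. ?\<psi> x $ k = 0" for x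
  proof -
    have "card {fst x, snd x} < CARD('n)"
      using d card_insert_le_m1[of 2 "{snd x}" "fst x"] by simp
    then obtain k where "k \<notin> {fst x, snd x}"
      by (metis UNIV_eq_I less_irrefl)
    then show ?thesis by (intro exI[of _ k]) (auto simp: split_beta)
  qed
qed (use d in auto)

section \<open>Attainment of the bound and conclusion\<close>

lemma symmetric_state_attains:
  fixes K :: real
  assumes "0 \<le> K" "K \<le> 1" "CARD('n) = 1 \<Longrightarrow> K = 1" "CARD('n) = 2 \<Longrightarrow> 1 / 2 \<le> K"
  shows "max (1 - CARD('n) * (1 - K)) 0
    \<in> G_coherence_averages (symmetric_state_of_overlap K :: complex ^ 'n ^ 'n)"
proof -
  define d where "d = CARD('n)"
  have "0 < d" by (simp add: d_def)
  then consider "d = 1" | "2 \<le> d" "1 - 1 / d \<le> K" | "2 \<le> d" "K < 1 - 1 / d"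
    by linarith
  then show ?thesis
  proof cases
    case 1
    then show ?thesis using assms one_mem_G_coherence_averages[where 'n = 'n] by (simp add: d_def)
  next
    case 2
    \<comment> \<open>The endpoints have averages \<open>1\<close> and \<open>0\<close>, so the
      mixing weight that reaches \<open>K\<close> is the claimed value itself.\<close>
    define u where "u = 1 - d * (1 - K)"
    have u: "0 \<le> u" "u \<le> 1" using 2 assms by (auto simp: u_def field_simps)
    have K: "u * 1 + (1 - u) * (1 - 1 / d) = K" using 2 by (simp add: u_def field_simps)
    have "u * 1 + (1 - u) * 0 \<in> G_coherence_averages (symmetric_state_of_overlap K :: complex ^ 'n ^ 'n)"
      using G_coherence_averages_convex[OF one_mem_G_coherence_averages[where 'n = 'n]
          zero_mem_G_coherence_averages_punctured u] 2 K
      by (simp add: d_def symmetric_state_of_overlap_convex)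
    moreover have "max (1 - CARD('n) * (1 - K)) 0 = u" using u by (simp add: u_def d_def)
    ultimately show ?thesis by simp
  next
    case 3
    \<comment> \<open>For \<open>d = 2\<close> the threshold \<open>1 - 1 / d\<close> is
      \<open>1 / 2\<close>, so the hypothesis excludes this case.\<close>
    then have d: "3 \<le> d" using assms(4) by (cases "d = 2") (auto simp: d_def)
    define u where "u = K / (1 - 1 / d)"
    have "1 - 1 / d > 0" using d by simp
    then have u: "0 \<le> u" "u \<le> 1" and K: "u * (1 - 1 / d) + (1 - u) * 0 = K"
      using 3 assms by (auto simp: u_def)
    have "0 \<in> G_coherence_averages (symmetric_state_of_overlap K :: complex ^ 'n ^ 'n)"
      using G_coherence_averages_convex[OF zero_mem_G_coherence_averages_punctured[where 'n = 'n]
          zero_mem_G_coherence_averages_antisymmetric u] 3 d K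
      by (simp add: d_def symmetric_state_of_overlap_convex)
    moreover have "1 - d * (1 - K) \<le> 0" using 3 d by (simp add: field_simps)
    ultimately show ?thesis by (simp add: d_def max_def)
  qed
qed

text \<open>The restriction for \<open>d = 2\<close> excludes genuine counterexamples: at
  \<open>K = 0\<close> the state is the projector onto \<open>(|1> - |2>) / sqrt 2\<close>, of
  coherence \<open>1\<close>, whereas the formula gives \<open>0\<close>.\<close>

theorem theorem3:
  fixes \<rho> :: "complex ^ 'n ^ 'n" and K :: real
  assumes "\<rho> \<in> symmetric_states"
    and "K = overlap \<rho> max_coherent"
    and "CARD('n) = 2 \<Longrightarrow> K \<ge> 1 / 2"
  shows "G_coherence \<rho> = max (1 - real CARD('n) * (1 - K)) 0 \<and>
         G_coherence \<rho> \<in> G_coherence_averages \<rho>"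
proof -
  note sym = symmetric_states_eq[OF assms(1), folded assms(2)]
  let ?m = "max (1 - real CARD('n) * (1 - K)) 0"
  have mem: "?m \<in> G_coherence_averages \<rho>"
    using symmetric_state_attains[where 'n = 'n, OF sym(2,3,4) assms(3)] by (simp flip: sym(1))
  moreover have "?m \<le> a" if "a \<in> G_coherence_averages \<rho>" for a
    using G_coherence_averages_ge[OF that] by (simp add: assms(2))
  ultimately have "G_coherence \<rho> = ?m"
    unfolding G_coherence_def by (rule cInf_eq_minimum)
  with mem show ?thesis by simp
qed

end
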